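(* Let $G=(V,E,p)$ be a directed acyclic network with edge failure probabilities $p:E\to[0,1]$, intactness probabilities $q(e)=1-p(e)$, and terminals $s,t\in V$. Let $H$ be the set of all subsets $h\subseteq E$ (states), with weight $w(h)=\prod_{e\in h}q(e)\prod_{e\in E\setminus h}p(e)$. For a state $h$ let $\mathcal P(h)$ be the set of directed $s$-$t$ paths all of whose edges lie in $h$, let $\mathcal P$ be the set of all directed $s$-$t$ paths in $G$ (a path being identified with its edge set), and let $A=\{h\in H:\mathcal P(h)\neq\emptyset\}$, so that $w(A)=\mathit{REL}_{s,t}(G)$ is the probability that an $s$-$t$ path survives when edges fail independently. For a path $\gamma$ let $w(\gamma)=\prod_{e\in\gamma}q(e)$. Let $\Omega=\{(\gamma,a)\in\mathcal P\times A:\gamma\subseteq a\}$ with weight $w(\gamma,a)=w(a)$, so that $w(\Omega)=\sum_{\gamma\in\mathcal P}w(\gamma)$; assume $w(A)>0$. A sample $(\gamma,a)$ from $\Omega$ is drawn by choosing $\gamma\in\mathcal P$ with probability $w(\gamma)/w(\Omega)$ and then letting $a=\gamma\cup\{e\in E\setminus\gamma: e\text{ appears}\}$, where each $e\in E\setminus\gamma$ appears independently with probability $q(e)$; thus $(\gamma,a)$ has probability $w(a)/w(\Omega)$. Fix for every $a\in A$ a path $\gamma_a\in\mathcal P(a)$. Draw $N$ independent samples $(\gamma_i,a_i)$, $i=1,\dots,N$, in this way, and define $\xi_N=\frac1N\,|\{i:\gamma_i=\gamma_{a_i}\}|$ and $\psi_N=\frac1N\sum_{i=1}^N\frac{1}{|\mathcal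 P(a_i)|}$. Let $0<\epsilon<1$, $0<\delta<1$. If $$N\geq 4(e-2)\ln\left(\frac{2}{\delta}\right)\frac{w(\Omega)}{\epsilon^2 w(A)},$$ then both $w(\Omega)\cdot\xi_N$ and $w(\Omega)\cdot\psi_N$ are $\epsilon$-$\delta$ approximations of $\mathit{REL}_{s,t}(G)$, i.e. each lies in $[(1-\epsilon)\mathit{REL}_{s,t}(G),(1+\epsilon)\mathit{REL}_{s,t}(G)]$ with probability at least $1-\delta$.
   Context: Here $e$ in $4(e-2)$ denotes Euler's number. An $\epsilon$-$\delta$ approximation of a quantity is a random estimate within relative error $\epsilon$ of the quantity with probability at least $1-\delta$. *)

theory Defs
  imports "HOL-Probability.Probability" "Graph_Theory.Graph_Theory"
begin

definition acyclic_digraph :: "('v, 'e) pre_digraph \<Rightarrow> bool" where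
  "acyclic_digraph G \<longleftrightarrow> (\<nexists>c. pre_digraph.cycle G c)"

text \<open>A path is identified with its set of arcs. For \<open>s = t\<close> the trivial path, with
  empty arc set, counts as a path.\<close>

definition st_paths :: "('v, 'e) pre_digraph \<Rightarrow> 'v \<Rightarrow> 'v \<Rightarrow> 'e set set" where
  "st_paths G s t = {set \<pi> | \<pi>. pre_digraph.apath G s \<pi> t}"

definition st_paths_in :: "('v, 'e) pre_digraph \<Rightarrow> 'v \<Rightarrow> 'v \<Rightarrow> 'e set \<Rightarrow> 'e set set" where
  "st_paths_in G s t h = {\<gamma> \<in> st_paths G s t. \<gamma> \<subseteq> h}"

text \<open>Throughout, \<open>p\<close> gives the failure probabilities, so that \<open>q e = 1 - p e\<close>.\<close>

definition state_weight :: "('v, 'e) pre_digraph \<Rightarrow> ('e \<Rightarrow> real) \<Rightarrow> 'e set \<Rightarrow> real" where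
  "state_weight G p h = (\<Prod>e\<in>h. 1 - p e) * (\<Prod>e\<in>arcs G - h. p e)"

definition path_weight :: "('e \<Rightarrow> real) \<Rightarrow> 'e set \<Rightarrow> real" where
  "path_weight p \<gamma> = (\<Prod>e\<in>\<gamma>. 1 - p e)"

definition good_states :: "('v, 'e) pre_digraph \<Rightarrow> 'v \<Rightarrow> 'v \<Rightarrow> 'e set set" where
  "good_states G s t = {h \<in> Pow (arcs G). st_paths_in G s t h \<noteq> {}}"

definition weight_A :: "('v, 'e) pre_digraph \<Rightarrow> ('e \<Rightarrow> real) \<Rightarrow> 'v \<Rightarrow> 'v \<Rightarrow> real" where
  "weight_A G p s t = (\<Sum>h\<in>good_states G s t. state_weight G p h)"

definition path_states :: "('v, 'e) pre_digraph \<Rightarrow> 'v \<Rightarrow> 'v \<Rightarrow> ('e set \<times> 'e set) set" where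
  "path_states G s t = {(\<gamma>, a) \<in> st_paths G s t \<times> good_states G s t. \<gamma> \<subseteq> a}"

definition weight_Omega :: "('v, 'e) pre_digraph \<Rightarrow> ('e \<Rightarrow> real) \<Rightarrow> 'v \<Rightarrow> 'v \<Rightarrow> real" where
  "weight_Omega G p s t = (\<Sum>(\<gamma>, a)\<in>path_states G s t. state_weight G p a)"

text \<open>The random set of intact arcs when the arcs in \<open>F\<close> fail independently.\<close>

definition intact_arcs :: "('e \<Rightarrow> real) \<Rightarrow> 'e set \<Rightarrow> 'e set pmf" where
  "intact_arcs p F =
     map_pmf (\<lambda>f. {e \<in> F. f e}) (Pi_pmf F False (\<lambda>e. bernoulli_pmf (1 - p e)))"

definition REL :: "('v, 'e) pre_digraph \<Rightarrow> ('e \<Rightarrow> real) \<Rightarrow> 'v \<Rightarrow> 'v \<Rightarrow> real" where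
  "REL G p s t = measure_pmf.prob (intact_arcs p (arcs G)) {h. st_paths_in G s t h \<noteq> {}}"

text \<open>That the following really defines a probability mass function is the lemma
  \<open>pmf_path_pmf\<close> below.\<close>

definition path_pmf :: "('v, 'e) pre_digraph \<Rightarrow> ('e \<Rightarrow> real) \<Rightarrow> 'v \<Rightarrow> 'v \<Rightarrow> 'e set pmf" where
  "path_pmf G p s t =
     embed_pmf (\<lambda>\<gamma>. if \<gamma> \<in> st_paths G s t then path_weight p \<gamma> / weight_Omega G p s t else 0)"

definition sample_pmf ::
    "('v, 'e) pre_digraph \<Rightarrow> ('e \<Rightarrow> real) \<Rightarrow> 'v \<Rightarrow> 'v \<Rightarrow> ('e set \<times> 'e set) pmf" where
  "sample_pmf G p s t =
     bind_pmf (path_pmf G p s t) (\<lambda>\<gamma>.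
       map_pmf (\<lambda>S. (\<gamma>, \<gamma> \<union> S)) (intact_arcs p (arcs G - \<gamma>)))"

text \<open>The two estimators, as functions of the samples \<open>x 1, \<dots>, x N\<close>; the map \<open>c\<close>
  is the choice of a path \<open>c a\<close> in every good state \<open>a\<close>.\<close>

definition xi :: "('e set \<Rightarrow> 'e set) \<Rightarrow> nat \<Rightarrow> (nat \<Rightarrow> 'e set \<times> 'e set) \<Rightarrow> real" where
  "xi c N x = 1 / real N * real (card {i \<in> {1..N}. fst (x i) = c (snd (x i))})"

definition psi ::
    "('v, 'e) pre_digraph \<Rightarrow> 'v \<Rightarrow> 'v \<Rightarrow> nat \<Rightarrow> (nat \<Rightarrow> 'e set \<times> 'e set) \<Rightarrow> real" where
  "psi G s t N x = 1 / real N * (\<Sum>i=1..N. 1 / real (card (st_paths_in G s t (snd (x i)))))"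

definition eps_delta_approximation ::
    "'m measure \<Rightarrow> ('m \<Rightarrow> real) \<Rightarrow> real \<Rightarrow> real \<Rightarrow> real \<Rightarrow> bool" where
  "eps_delta_approximation M Z \<mu> \<epsilon> \<delta> \<longleftrightarrow>
     Z \<in> borel_measurable M \<and>
     measure M {\<omega> \<in> space M. (1 - \<epsilon>) * \<mu> \<le> Z \<omega> \<and> Z \<omega> \<le> (1 + \<epsilon>) * \<mu>} \<ge> 1 - \<delta>"

lemma st_paths_subset_arcs: "\<gamma> \<in> st_paths G s t \<Longrightarrow> \<gamma> \<subseteq> arcs G"
  by (auto simp: st_paths_def pre_digraph.apath_def pre_digraph.awalk_def)

lemma sum_state_weight_superset:
  assumes fin: "finite (arcs G)" and sub: "\<gamma> \<subseteq> arcs G"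
  shows "(\<Sum>a\<in>{a \<in> Pow (arcs G). \<gamma> \<subseteq> a}. state_weight G p a) = path_weight p \<gamma>"
proof -
  let ?F = "arcs G - \<gamma>"
  have fg: "finite \<gamma>" using fin sub finite_subset by blast
  have "(\<Sum>a\<in>{a \<in> Pow (arcs G). \<gamma> \<subseteq> a}. state_weight G p a)
      = (\<Sum>S\<in>Pow ?F. state_weight G p (\<gamma> \<union> S))"
    by (rule sum.reindex_bij_witness[where i = "\<lambda>S. \<gamma> \<union> S" and j = "\<lambda>a. a - \<gamma>"])
      (use sub in \<open>auto simp: Un_absorb1\<close>)
  also have "\<dots> = (\<Sum>S\<in>Pow ?F. path_weight p \<gamma> * ((\<Prod>e\<in>S. 1 - p e) * (\<Prod>e\<in>?F - S. p e)))"
  proof (rule sum.cong[OF refl])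
    fix S assume S: "S \<in> Pow ?F"
    have "finite S" using S fin finite_subset by blast
    moreover have "arcs G - (\<gamma> \<union> S) = ?F - S" by blast
    ultimately show "state_weight G p (\<gamma> \<union> S)
        = path_weight p \<gamma> * ((\<Prod>e\<in>S. 1 - p e) * (\<Prod>e\<in>?F - S. p e))"
      using S fg unfolding state_weight_def path_weight_def
      by (subst prod.union_disjoint) auto
  qed
  also have "\<dots> = path_weight p \<gamma> * (\<Prod>e\<in>?F. (1 - p e) + p e)"
    using fin by (subst prod_add) (auto simp: sum_distrib_left)
  finally show ?thesis by simp
qed

lemma weight_Omega_eq:
  assumes "finite (arcs G)"
  shows "weight_Omega G p s t = (\<Sum>\<gamma>\<in>st_paths G s t. path_weight p \<gamma>)"
proof -
  have finP: "finite (st_paths G s t)"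
    by (rule finite_subset[of _ "Pow (arcs G)"]) (use assms in \<open>auto dest: st_paths_subset_arcs\<close>)
  have "path_states G s t = (SIGMA \<gamma>:st_paths G s t. {a \<in> Pow (arcs G). \<gamma> \<subseteq> a})"
    unfolding path_states_def good_states_def st_paths_in_def by blast
  then have "weight_Omega G p s t
      = (\<Sum>\<gamma>\<in>st_paths G s t. \<Sum>a\<in>{a \<in> Pow (arcs G). \<gamma> \<subseteq> a}. state_weight G p a)"
    unfolding weight_Omega_def using finP assms by (simp add: sum.Sigma)
  then show ?thesis
    using sum_state_weight_superset[OF assms st_paths_subset_arcs] by (simp cong: sum.cong)
qed

lemma pmf_path_pmf:
  assumes fin: "finite (arcs G)" and p: "\<forall>e\<in>arcs G. 0 \<le> p e \<and> p e \<le> 1"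
    and pos: "weight_A G p s t > 0"
  shows "pmf (path_pmf G p s t) \<gamma> =
    (if \<gamma> \<in> st_paths G s t then path_weight p \<gamma> / weight_Omega G p s t else 0)"
proof -
  let ?P = "st_paths G s t" and ?W = "weight_Omega G p s t"
  let ?f = "\<lambda>\<gamma>. if \<gamma> \<in> ?P then path_weight p \<gamma> / ?W else 0"
  have sub: "\<And>\<gamma>. \<gamma> \<in> ?P \<Longrightarrow> \<gamma> \<subseteq> arcs G" by (rule st_paths_subset_arcs)
  have finP: "finite ?P"
    by (rule finite_subset[of _ "Pow (arcs G)"]) (use fin sub in auto)
  have finA: "finite (good_states G s t)"
    by (rule finite_subset[of _ "Pow (arcs G)"]) (use fin in \<open>auto simp: good_states_def\<close>)
  have sw: "state_weight G p a \<ge> 0" if "a \<subseteq> arcs G" for a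
    unfolding state_weight_def using that p
    by (intro mult_nonneg_nonneg prod_nonneg) auto
  have pw: "path_weight p \<gamma> \<ge> 0" if "\<gamma> \<in> ?P" for \<gamma>
    unfolding path_weight_def using sub[OF that] p by (intro prod_nonneg) auto
  have finO: "finite (path_states G s t)"
    by (rule finite_subset[of _ "?P \<times> good_states G s t"])
      (use finP finA in \<open>auto simp: path_states_def\<close>)
  have "good_states G s t \<subseteq> snd ` path_states G s t"
  proof
    fix a assume a: "a \<in> good_states G s t"
    then obtain \<gamma> where "\<gamma> \<in> ?P" "\<gamma> \<subseteq> a"
      unfolding good_states_def st_paths_in_def by blast
    with a have "(\<gamma>, a) \<in> path_states G s t" by (simp add: path_states_def)
    then show "a \<in> snd ` path_states G s t" by force
  qed
  then have "weight_A G p s t \<le> (\<Sum>a\<in>snd ` path_states G s t. state_weight G p a)"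
    unfolding weight_A_def using finO
    by (intro sum_mono2) (auto intro!: sw simp: path_states_def good_states_def)
  also have "\<dots> \<le> (\<Sum>x\<in>path_states G s t. state_weight G p (snd x))"
    using sum_image_le[OF finO, of "state_weight G p" snd] sw
    by (auto simp: path_states_def good_states_def o_def)
  finally have W: "?W > 0"
    using pos by (simp add: weight_Omega_def case_prod_unfold)
  have nonneg: "\<And>\<gamma>. ?f \<gamma> \<ge> 0" using pw W by auto
  have "(\<integral>\<^sup>+\<gamma>. ennreal (?f \<gamma>) \<partial>count_space UNIV) = (\<integral>\<^sup>+\<gamma>. ennreal (?f \<gamma>) \<partial>count_space ?P)"
    by (rule nn_integral_count_space_eq) auto
  also have "\<dots> = (\<Sum>\<gamma>\<in>?P. ennreal (?f \<gamma>))"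
    by (rule nn_integral_count_space_finite[OF finP])
  also have "\<dots> = ennreal (\<Sum>\<gamma>\<in>?P. ?f \<gamma>)"
    by (rule sum_ennreal) (rule nonneg)
  also have "(\<Sum>\<gamma>\<in>?P. ?f \<gamma>) = 1"
    using W weight_Omega_eq[OF fin, of p s t] by (simp add: sum_divide_distrib[symmetric])
  finally show ?thesis
    unfolding path_pmf_def by (subst pmf_embed_pmf[OF nonneg]) (simp_all only: ennreal_1)
qed

end

theory Submission
  imports Defs
begin

text \<open>Both estimators average \<open>N\<close> independent \<open>[0,1]\<close>-valued variables with mean
  \<open>\<mu> = w(A) / w(\<Omega>)\<close>, because a sample \<open>(\<gamma>, a)\<close> has probability \<open>w(a) / w(\<Omega>)\<close>.
  For \<open>Y\<close> in \<open>[0,1]\<close>, convexity gives \<open>E exp(lY) \<le> exp(\<mu> (exp l - 1))\<close>, and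
  \<open>exp l - 1 - l \<le> (e - 2) l\<^sup>2\<close> for \<open>\<bar>l\<bar> \<le> 1\<close>. Chernoff's method with
  \<open>l = \<plusminus>\<epsilon> / (2 (e - 2))\<close> bounds each tail by \<open>exp(- N \<mu> \<epsilon>\<^sup>2 / (4 (e - 2))) \<le> \<delta> / 2\<close>.\<close>

section \<open>A multiplicative Chernoff bound\<close>

text \<open>In the Taylor series each term of order \<open>n + 2\<close> is at most
  \<open>x\<^sup>2\<close> times its value at \<open>x = 1\<close>, because
  \<open>\<bar>x\<bar> ^ n \<le> 1\<close>. Those values add up to \<open>exp 1 - 2\<close>, the
  source of Euler's number in the sample size.\<close>

lemma exp_minus_linear_le:
  fixes x :: real
  assumes "\<bar>x\<bar> \<le> 1"
  shows "exp x - 1 - x \<le> (exp 1 - 2) * x\<^sup>2"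
proof -
  let ?a = "\<lambda>x n. inverse (fact (n + 2)) *\<^sub>R ((x::real) ^ (n + 2))"
  have summable: "summable (?a y)" for y
    using summable_exp_generic[of y] by (subst summable_iff_shift) (simp add: divide_inverse mult.commute)
  have "exp x - 1 - x = (\<Sum>n. ?a x n)"
    by (subst exp_first_two_terms) simp
  also have "\<dots> \<le> (\<Sum>n. x\<^sup>2 * ?a 1 n)"
  proof (rule suminf_le[OF _ summable summable_mult[OF summable]])
    fix n
    have "x ^ n \<le> \<bar>x\<bar> ^ n" by (metis abs_ge_self power_abs)
    also have "\<dots> \<le> 1" using assms by (simp add: power_le_one)
    finally have "x\<^sup>2 * x ^ n \<le> x\<^sup>2 * 1" by (rule mult_left_mono) simp
    then have "x ^ (n + 2) \<le> x\<^sup>2"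
      by (simp add: power_add mult.commute del: add_2_eq_Suc')
    then show "?a x n \<le> x\<^sup>2 * ?a 1 n"
      by (simp add: mult.commute mult_left_mono del: fact_Suc add_2_eq_Suc')
  qed
  also have "\<dots> = x\<^sup>2 * (\<Sum>n. ?a 1 n)" by (rule suminf_mult[OF summable])
  also have "(\<Sum>n. ?a 1 n) = exp 1 - 2"
    using exp_first_two_terms[of "1::real"] by simp
  finally show ?thesis by (simp add: mult.commute)
qed

text \<open>Keeps the Chernoff parameter \<epsilon> / (2 (e - 2)) at most 1, inside the range of
  \<open>exp_minus_linear_le\<close>.\<close>

lemma exp_one_minus_two_ge: "exp 1 - 2 \<ge> (1 / 2 :: real)"
  using exp_lower_Taylor_quadratic[of 1] by simp

lemma exp_mult_le_chord:
  fixes l y :: real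
  assumes "0 \<le> y" "y \<le> 1"
  shows "exp (l * y) \<le> 1 + y * (exp l - 1)"
  using convex_onD[OF exp_convex, of y 0 l] assms by (simp add: algebra_simps)

context prob_space
begin

text \<open>The chord bound is affine in \<open>Y\<close>, so its expectation depends on the mean
  only; then 1 + x \<le> exp x. The bound is the moment generating function of a Poisson variable
  with the same mean.\<close>

lemma mgf_unit_interval_le:
  fixes Y :: "'a \<Rightarrow> real"
  assumes "random_variable borel Y" and Y: "\<And>\<omega>. 0 \<le> Y \<omega> \<and> Y \<omega> \<le> 1"
  shows "expectation (\<lambda>\<omega>. exp (l * Y \<omega>)) \<le> exp (expectation Y * (exp l - 1))"
    and "integrable M (\<lambda>\<omega>. exp (l * Y \<omega>))"
proof -
  have [measurable]: "Y \<in> borel_measurable M" by fact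
  have int: "integrable M Y"
    by (rule integrable_const_bound[where B = 1]) (use Y in auto)
  have "exp (l * Y \<omega>) \<le> exp \<bar>l\<bar>" for \<omega>
  proof -
    have "l * Y \<omega> \<le> \<bar>l\<bar> * Y \<omega>" using Y by (intro mult_right_mono) auto
    also have "\<dots> \<le> \<bar>l\<bar>" using Y by (simp add: mult_left_le)
    finally show ?thesis by simp
  qed
  then show int_exp: "integrable M (\<lambda>\<omega>. exp (l * Y \<omega>))"
    by (intro integrable_const_bound[where B = "exp \<bar>l\<bar>"]) auto
  have "expectation (\<lambda>\<omega>. exp (l * Y \<omega>)) \<le> expectation (\<lambda>\<omega>. 1 + Y \<omega> * (exp l - 1))"
    using int int_exp Y by (intro integral_mono exp_mult_le_chord) auto
  also have "\<dots> = 1 + expectation Y * (exp l - 1)"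
    using int by (simp add: prob_space)
  also have "\<dots> \<le> exp (expectation Y * (exp l - 1))" by (rule exp_ge_add_one_self)
  finally show "expectation (\<lambda>\<omega>. exp (l * Y \<omega>)) \<le> exp (expectation Y * (exp l - 1))" .
qed

text \<open>Positive \<open>l\<close> controls the upper tail and negative \<open>l\<close> the lower one.\<close>

lemma chernoff_one_sided:
  fixes Y :: "'i \<Rightarrow> 'a \<Rightarrow> real"
  assumes fin: "finite I" and indep: "indep_vars (\<lambda>_. borel) Y I"
    and Y: "\<And>i \<omega>. 0 \<le> Y i \<omega> \<and> Y i \<omega> \<le> 1"
    and mean: "\<And>i. i \<in> I \<Longrightarrow> expectation (Y i) = \<mu>"
    and l: "\<bar>l\<bar> \<le> 1" and \<mu>: "0 \<le> \<mu>"
  shows "prob {\<omega> \<in> space M. l * (\<Sum>i\<in>I. Y i \<omega>) \<ge> l * (real (card I) * \<mu>) + d}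
    \<le> exp (real (card I) * \<mu> * (exp 1 - 2) * l\<^sup>2 - d)"
proof -
  let ?n = "real (card I)"
  have rv: "random_variable borel (Y i)" if "i \<in> I" for i
    using indep that by (auto simp: indep_vars_def)
  have indep': "indep_vars (\<lambda>_. borel) (\<lambda>i \<omega>. exp (l * Y i \<omega>)) I"
    by (rule indep_vars_compose2[OF indep]) simp
  have prod: "exp (l * (\<Sum>i\<in>I. Y i \<omega>)) = (\<Prod>i\<in>I. exp (l * Y i \<omega>))" for \<omega>
    using fin by (simp add: sum_distrib_left exp_sum)
  have int: "integrable M (\<lambda>\<omega>. exp (l * (\<Sum>i\<in>I. Y i \<omega>)))"
    unfolding prod by (rule indep_vars_integrable[OF fin indep' mgf_unit_interval_le(2)[OF rv Y]])
  have "expectation (\<lambda>\<omega>. exp (l * (\<Sum>i\<in>I. Y i \<omega>))) = (\<Prod>i\<in>I. expectation (\<lambda>\<omega>. exp (l * Y i \<omega>)))"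
    unfolding prod
    by (rule indep_vars_lebesgue_integral[OF fin indep' mgf_unit_interval_le(2)[OF rv Y]])
  also have "\<dots> \<le> (\<Prod>i\<in>I. exp (\<mu> * (exp l - 1)))"
    using mgf_unit_interval_le(1)[OF rv Y] mean by (intro prod_mono) (auto intro!: integral_nonneg)
  also have "\<dots> = exp (?n * (\<mu> * (exp l - 1)))" by (simp add: exp_of_nat_mult)
  finally have mgf: "expectation (\<lambda>\<omega>. exp (l * (\<Sum>i\<in>I. Y i \<omega>))) \<le> exp (?n * (\<mu> * (exp l - 1)))" .
  have "prob {\<omega> \<in> space M. l * (\<Sum>i\<in>I. Y i \<omega>) \<ge> l * (?n * \<mu>) + d}
      = prob {\<omega> \<in> space M. exp (l * (\<Sum>i\<in>I. Y i \<omega>)) \<ge> exp (l * (?n * \<mu>) + d)}"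
    by simp
  also have "\<dots> \<le> expectation (\<lambda>\<omega>. exp (l * (\<Sum>i\<in>I. Y i \<omega>))) / exp (l * (?n * \<mu>) + d)"
    by (rule integral_Markov_inequality_measure[OF int, where A = "{}"]) auto
  also have "\<dots> \<le> exp (?n * (\<mu> * (exp l - 1))) / exp (l * (?n * \<mu>) + d)"
    using mgf by (rule divide_right_mono) simp
  \<comment> \<open>The threshold is measured from the mean, so division removes the linear term of
    \<open>exp l - 1\<close> and leaves a quantity quadratic in \<open>l\<close>.\<close>
  also have "\<dots> = exp (?n * \<mu> * (exp l - 1 - l) - d)"
    by (simp add: exp_diff[symmetric] algebra_simps)
  also have "\<dots> \<le> exp (?n * \<mu> * ((exp 1 - 2) * l\<^sup>2) - d)"
    using mult_left_mono[OF exp_minus_linear_le[OF l], of "?n * \<mu>"] \<mu> by simp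
  finally show ?thesis by (simp add: mult.assoc)
qed

text \<open>Union bound over the two tails; the resulting factor 2 is what the 2 in
  \<open>ln (2 / \<delta>)\<close> compensates.\<close>

lemma chernoff_relative_error:
  fixes Y :: "'i \<Rightarrow> 'a \<Rightarrow> real"
  assumes fin: "finite I" and indep: "indep_vars (\<lambda>_. borel) Y I"
    and Y: "\<And>i \<omega>. 0 \<le> Y i \<omega> \<and> Y i \<omega> \<le> 1"
    and mean: "\<And>i. i \<in> I \<Longrightarrow> expectation (Y i) = \<mu>"
    and \<mu>: "0 \<le> \<mu>" and \<epsilon>: "0 < \<epsilon>" "\<epsilon> \<le> 1"
  shows "prob {\<omega> \<in> space M. (1 - \<epsilon>) * (real (card I) * \<mu>) \<le> (\<Sum>i\<in>I. Y i \<omega>)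
      \<and> (\<Sum>i\<in>I. Y i \<omega>) \<le> (1 + \<epsilon>) * (real (card I) * \<mu>)}
    \<ge> 1 - 2 * exp (- (real (card I) * \<mu> * \<epsilon>\<^sup>2 / (4 * (exp 1 - 2))))"
proof -
  define m where "m = real (card I) * \<mu>"
  \<comment> \<open>For \<open>m > 0\<close> this minimises the exponent
    \<open>m * (exp 1 - 2) * l\<^sup>2 - l * (\<epsilon> * m)\<close> that
    \<open>chernoff_one_sided\<close> gives for a deviation of
    \<open>\<epsilon> * m\<close>.\<close>
  define l where "l = \<epsilon> / (2 * (exp 1 - 2))"
  define B where "B = exp (- (m * \<epsilon>\<^sup>2 / (4 * (exp 1 - 2))))"
  let ?S = "\<lambda>\<omega>. \<Sum>i\<in>I. Y i \<omega>"
  have e: "exp 1 - 2 \<ge> (1 / 2 :: real)" by (rule exp_one_minus_two_ge)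
  have l: "0 < l" "l \<le> 1" using e \<epsilon> by (auto simp: l_def field_simps)
  have [measurable]: "random_variable borel (Y i)" if "i \<in> I" for i
    using indep that by (auto simp: indep_vars_def)
  have expo: "m * (exp 1 - 2) * l\<^sup>2 - l * (\<epsilon> * m) = - (m * \<epsilon>\<^sup>2 / (4 * (exp 1 - 2)))"
  proof -
    \<comment> \<open>With \<open>exp 1 - 2\<close> generalised to an atom \<open>k\<close>, only a
      rational identity remains.\<close>
    have optimum: "m * k * (\<epsilon> / (2 * k))\<^sup>2 - \<epsilon> / (2 * k) * (\<epsilon> * m) = - (m * \<epsilon>\<^sup>2 / (4 * k))"
      if "k > 0" for k
      using that by (simp add: power2_eq_square field_simps)
    show ?thesis unfolding l_def by (rule optimum) (use e in linarith)
  qed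
  \<comment> \<open>Here \<open>k\<close> is \<open>l\<close> for the upper tail and
    \<open>- l\<close> for the lower one; only \<open>k\<^sup>2\<close> enters the exponent, so one
    bound covers both.\<close>
  have tail: "prob {\<omega> \<in> space M. k * ?S \<omega> \<ge> k * m + l * (\<epsilon> * m)} \<le> B"
    if "\<bar>k\<bar> = l" for k
  proof -
    have "k\<^sup>2 = l\<^sup>2" using that by (metis power2_abs)
    moreover have "\<bar>k\<bar> \<le> 1" using that l by simp
    from chernoff_one_sided[OF fin indep Y mean this \<mu>, of "l * (\<epsilon> * m)"]
    have "prob {\<omega> \<in> space M. k * ?S \<omega> \<ge> k * m + l * (\<epsilon> * m)}
        \<le> exp (m * (exp 1 - 2) * k\<^sup>2 - l * (\<epsilon> * m))"
      by (simp only: m_def)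
    ultimately show ?thesis by (simp only: expo B_def)
  qed
  let ?U = "{\<omega> \<in> space M. l * ?S \<omega> \<ge> l * m + l * (\<epsilon> * m)}"
  let ?L = "{\<omega> \<in> space M. (- l) * ?S \<omega> \<ge> (- l) * m + l * (\<epsilon> * m)}"
  let ?G = "{\<omega> \<in> space M. (1 - \<epsilon>) * m \<le> ?S \<omega> \<and> ?S \<omega> \<le> (1 + \<epsilon>) * m}"
  have [measurable]: "?U \<in> events" "?L \<in> events" "?G \<in> events" by measurable
  have "space M - ?G \<subseteq> ?U \<union> ?L"
  proof
    fix \<omega> assume "\<omega> \<in> space M - ?G"
    then consider "\<omega> \<in> space M" "?S \<omega> \<ge> m + \<epsilon> * m" | "\<omega> \<in> space M" "?S \<omega> \<le> m - \<epsilon> * m"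
      by (auto simp: algebra_simps not_le dest: less_imp_le)
    then show "\<omega> \<in> ?U \<union> ?L"
    proof cases
      case 1
      then show ?thesis using mult_left_mono[of _ _ l, OF 1(2)] l by (simp add: algebra_simps)
    next
      case 2
      then show ?thesis using mult_left_mono[of _ _ l, OF 2(2)] l by (simp add: algebra_simps)
    qed
  qed
  then have "prob (space M - ?G) \<le> prob (?U \<union> ?L)"
    by (rule finite_measure_mono) measurable
  also have "\<dots> \<le> prob ?U + prob ?L"
    by (rule measure_Un_le) measurable
  also have "\<dots> \<le> B + B" using l by (intro add_mono tail) auto
  finally have "prob ?G \<ge> 1 - 2 * B" by (simp add: prob_compl)
  then show ?thesis by (simp add: m_def B_def)
qed

end

section \<open>The sampling distribution\<close>

lemma pmf_intact_arcs:
  assumes fin: "finite F" and p: "\<forall>e\<in>F. 0 \<le> p e \<and> p e \<le> 1" and S: "S \<subseteq> F"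
  shows "pmf (intact_arcs p F) S = (\<Prod>e\<in>S. 1 - p e) * (\<Prod>e\<in>F - S. p e)"
proof -
  let ?\<Pi> = "Pi_pmf F False (\<lambda>e. bernoulli_pmf (1 - p e))"
  \<comment> \<open>Other functions that induce \<open>S\<close> on \<open>F\<close> are true
    somewhere outside \<open>F\<close>, where the default \<open>False\<close> gives them
    probability 0.\<close>
  have "pmf (intact_arcs p F) S = measure_pmf.prob ?\<Pi> {\<lambda>e. e \<in> S}"
    unfolding intact_arcs_def pmf_map
    by (rule measure_prob_cong_0) (use S fin in \<open>auto simp: fun_eq_iff intro!: pmf_Pi_outside\<close>)
  also have "\<dots> = (\<Prod>e\<in>F. pmf (bernoulli_pmf (1 - p e)) (e \<in> S))"
    using S fin by (subst measure_pmf_single, subst pmf_Pi') auto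
  also have "\<dots> = (\<Prod>e\<in>F. if e \<in> S then 1 - p e else p e)"
    using p by (intro prod.cong) auto
  also have "\<dots> = (\<Prod>e\<in>S. 1 - p e) * (\<Prod>e\<in>F - S. p e)"
    using S fin by (simp add: prod.If_cases Int_absorb1 Diff_eq)
  finally show ?thesis .
qed

lemma set_pmf_intact_arcs: "set_pmf (intact_arcs p F) \<subseteq> Pow F"
  by (auto simp: intact_arcs_def)

section \<open>Weights of states and of path-state pairs\<close>

context
  fixes G :: "('v, 'e) pre_digraph" and p :: "'e \<Rightarrow> real" and s t :: 'v
  assumes fin: "finite (arcs G)" and p: "\<forall>e\<in>arcs G. 0 \<le> p e \<and> p e \<le> 1"
begin

lemma finite_good_states: "finite (good_states G s t)"
  by (rule finite_subset[of _ "Pow (arcs G)"]) (use fin in \<open>auto simp: good_states_def\<close>)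

lemma finite_st_paths_in: "finite (st_paths_in G s t a)"
  by (rule finite_subset[of _ "Pow (arcs G)"])
    (use fin in \<open>auto simp: st_paths_in_def dest: st_paths_subset_arcs\<close>)

text \<open>The intact set is almost surely a subset of \<open>arcs G\<close>, so the event in
  \<open>REL\<close> may be cut down to the good states; there its law is
  \<open>state_weight\<close>.\<close>

lemma REL_eq_weight_A: "REL G p s t = weight_A G p s t"
proof -
  have "REL G p s t = measure_pmf.prob (intact_arcs p (arcs G)) (good_states G s t)"
    unfolding REL_def
    by (rule measure_prob_cong_0)
      (use set_pmf_intact_arcs[of p "arcs G"] in \<open>auto simp: good_states_def pmf_eq_0_set_pmf\<close>)
  also have "\<dots> = (\<Sum>a\<in>good_states G s t. pmf (intact_arcs p (arcs G)) a)"
    by (rule measure_measure_pmf_finite[OF finite_good_states])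
  also have "\<dots> = weight_A G p s t"
    unfolding weight_A_def state_weight_def
    by (intro sum.cong pmf_intact_arcs[OF fin p]) (auto simp: good_states_def)
  finally show ?thesis .
qed

text \<open>Fibres the pairs over states rather than paths, because the estimators are evaluated by
  summing over all paths of a fixed state.\<close>

lemma path_states_eq_Sigma:
  "path_states G s t = prod.swap ` (SIGMA a:good_states G s t. st_paths_in G s t a)"
  by (force simp: path_states_def st_paths_in_def)

lemma finite_path_states: "finite (path_states G s t)"
  unfolding path_states_eq_Sigma using finite_good_states finite_st_paths_in by blast

lemma sum_path_states:
  "(\<Sum>x\<in>path_states G s t. f x)
    = (\<Sum>a\<in>good_states G s t. \<Sum>\<gamma>\<in>st_paths_in G s t a. f (\<gamma>, a))"
  unfolding path_states_eq_Sigma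
  by (subst sum.reindex) (simp_all add: sum.Sigma finite_good_states finite_st_paths_in case_prod_unfold prod.swap_def)

text \<open>Each good state is counted once per surviving path, hence at least once. This makes
  w(\<Omega>) positive when w(A) is.\<close>

lemma weight_A_le_weight_Omega: "weight_A G p s t \<le> weight_Omega G p s t"
proof -
  have "state_weight G p a \<le> (\<Sum>\<gamma>\<in>st_paths_in G s t a. state_weight G p a)"
    if "a \<in> good_states G s t" for a
  proof -
    have "card (st_paths_in G s t a) \<ge> 1"
      using that finite_st_paths_in by (auto simp: good_states_def Suc_le_eq card_gt_0_iff)
    moreover have "state_weight G p a \<ge> 0"
      unfolding state_weight_def using that p
      by (intro mult_nonneg_nonneg prod_nonneg) (auto simp: good_states_def)
    ultimately show ?thesis
      by (simp add: mult_le_cancel_right1)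
  qed
  then show ?thesis
    unfolding weight_A_def weight_Omega_def by (subst sum_path_states) (simp add: sum_mono)
qed

section \<open>Law and mean of a single sample\<close>

context
  assumes pos: "weight_A G p s t > 0"
begin

lemma set_pmf_sample_pmf: "set_pmf (sample_pmf G p s t) \<subseteq> path_states G s t"
proof
  fix x assume "x \<in> set_pmf (sample_pmf G p s t)"
  then obtain \<gamma> S where x: "x = (\<gamma>, \<gamma> \<union> S)" and \<gamma>: "\<gamma> \<in> set_pmf (path_pmf G p s t)"
    and S: "S \<in> set_pmf (intact_arcs p (arcs G - \<gamma>))"
    by (auto simp: sample_pmf_def)
  have "\<gamma> \<in> st_paths G s t"
    using \<gamma> by (auto simp: set_pmf_iff pmf_path_pmf[OF fin p pos] split: if_splits)
  moreover have "S \<subseteq> arcs G" using S set_pmf_intact_arcs[of p "arcs G - \<gamma>"] by blast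
  ultimately show "x \<in> path_states G s t"
    using st_paths_subset_arcs[of \<gamma> G s t]
    by (auto simp: x path_states_def good_states_def st_paths_in_def)
qed

text \<open>The factor w(\<gamma>) from drawing the path supplies exactly the arcs of
  \<open>\<gamma>\<close> missing from the conditional law of the rest, so the product no longer
  depends on \<open>\<gamma>\<close>.\<close>

lemma pmf_sample_pmf:
  assumes "(\<gamma>, a) \<in> path_states G s t"
  shows "pmf (sample_pmf G p s t) (\<gamma>, a) = state_weight G p a / weight_Omega G p s t"
proof -
  from assms have \<gamma>: "\<gamma> \<in> st_paths G s t" "\<gamma> \<subseteq> a" and a: "a \<subseteq> arcs G"
    by (auto simp: path_states_def good_states_def)
  let ?I = "\<lambda>\<gamma>'. intact_arcs p (arcs G - \<gamma>')"
  \<comment> \<open>The first component records the drawn path, so the mixture over paths collapses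
    to one term.\<close>
  have zero: "pmf (map_pmf (\<lambda>S. (\<gamma>', \<gamma>' \<union> S)) (?I \<gamma>')) (\<gamma>, a) = 0" if "\<gamma>' \<noteq> \<gamma>" for \<gamma>'
    using that by (auto simp: pmf_eq_0_set_pmf)
  \<comment> \<open>Sets \<open>S\<close> meeting \<open>\<gamma>\<close> may also satisfy
    \<open>\<gamma> \<union> S = a\<close>, but they have probability 0.\<close>
  have vim: "measure_pmf.prob (?I \<gamma>) ((\<lambda>S. (\<gamma>, \<gamma> \<union> S)) -` {(\<gamma>, a)}) = pmf (?I \<gamma>) (a - \<gamma>)"
  proof -
    have "measure_pmf.prob (?I \<gamma>) ((\<lambda>S. (\<gamma>, \<gamma> \<union> S)) -` {(\<gamma>, a)})
        = measure_pmf.prob (?I \<gamma>) {a - \<gamma>}"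
      by (rule measure_prob_cong_0)
        (use \<gamma> set_pmf_intact_arcs[of p "arcs G - \<gamma>"] in \<open>auto simp: pmf_eq_0_set_pmf\<close>)
    then show ?thesis by (simp add: measure_pmf_single)
  qed
  have "pmf (sample_pmf G p s t) (\<gamma>, a)
      = (\<Sum>\<gamma>'\<in>{\<gamma>}. pmf (map_pmf (\<lambda>S. (\<gamma>', \<gamma>' \<union> S)) (?I \<gamma>')) (\<gamma>, a) * pmf (path_pmf G p s t) \<gamma>')"
    unfolding sample_pmf_def pmf_bind
    by (rule integral_measure_pmf_real) (use zero in auto)
  also have "\<dots> = pmf (?I \<gamma>) (a - \<gamma>) * (path_weight p \<gamma> / weight_Omega G p s t)"
    using \<gamma> by (simp add: pmf_map vim pmf_path_pmf[OF fin p pos])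
  also have "pmf (?I \<gamma>) (a - \<gamma>) = (\<Prod>e\<in>a - \<gamma>. 1 - p e) * (\<Prod>e\<in>arcs G - \<gamma> - (a - \<gamma>). p e)"
    by (rule pmf_intact_arcs) (use fin p a in auto)
  also have "arcs G - \<gamma> - (a - \<gamma>) = arcs G - a" using \<gamma> a by blast
  finally show ?thesis
    using prod.subset_diff[OF \<gamma>(2) finite_subset[OF a fin], of "\<lambda>e. 1 - p e"]
    by (simp add: state_weight_def path_weight_def mult_ac)
qed

text \<open>As the law is constant on the fibre over a state, only the fibre sums of
  \<open>f\<close> matter. Sums equal to 1 count every good state once, which undoes the multiple
  counting in w(\<Omega>).\<close>

lemma expectation_sample_pmf:
  fixes f :: "'e set \<times> 'e set \<Rightarrow> real"
  assumes fibre: "\<And>a. a \<in> good_states G s t \<Longrightarrow> (\<Sum>\<gamma>\<in>st_paths_in G s t a. f (\<gamma>, a)) = 1"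
  shows "measure_pmf.expectation (sample_pmf G p s t) f = weight_A G p s t / weight_Omega G p s t"
proof -
  have "measure_pmf.expectation (sample_pmf G p s t) f
      = (\<Sum>x\<in>path_states G s t. f x * pmf (sample_pmf G p s t) x)"
    by (rule integral_measure_pmf_real[OF finite_path_states]) (use set_pmf_sample_pmf in blast)
  also have "\<dots> = (\<Sum>x\<in>path_states G s t. f x * (state_weight G p (snd x) / weight_Omega G p s t))"
    by (intro sum.cong) (auto simp: pmf_sample_pmf)
  also have "\<dots> = (\<Sum>a\<in>good_states G s t. (\<Sum>\<gamma>\<in>st_paths_in G s t a. f (\<gamma>, a))
      * (state_weight G p a / weight_Omega G p s t))"
    by (subst sum_path_states) (simp only: sum_distrib_right snd_conv)
  also have "\<dots> = weight_A G p s t / weight_Omega G p s t"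
    using fibre by (simp add: weight_A_def sum_divide_distrib)
  finally show ?thesis .
qed

text \<open>Treats both estimators at once: all that is asked of \<open>f\<close> is values in [0,1]
  and fibre sums 1.\<close>

lemma eps_delta_approximation_sample_mean:
  fixes M :: "'m measure" and X :: "nat \<Rightarrow> 'm \<Rightarrow> 'e set \<times> 'e set"
    and f :: "'e set \<times> 'e set \<Rightarrow> real"
  assumes "prob_space M"
    and indep: "prob_space.indep_vars M (\<lambda>_. count_space UNIV) X {1..N}"
    and distr: "\<forall>i\<in>{1..N}. distr M (count_space UNIV) (X i) = measure_pmf (sample_pmf G p s t)"
    and \<epsilon>: "0 < \<epsilon>" "\<epsilon> < 1" and \<delta>: "0 < \<delta>" "\<delta> < 1"
    and N: "real N \<ge> 4 * (exp 1 - 2) * ln (2 / \<delta>)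
      * (weight_Omega G p s t / (\<epsilon>\<^sup>2 * weight_A G p s t))"
    and f: "\<And>x. 0 \<le> f x \<and> f x \<le> 1"
    and fibre: "\<And>a. a \<in> good_states G s t \<Longrightarrow> (\<Sum>\<gamma>\<in>st_paths_in G s t a. f (\<gamma>, a)) = 1"
  shows "eps_delta_approximation M
    (\<lambda>\<omega>. weight_Omega G p s t * (1 / real N * (\<Sum>i=1..N. f (X i \<omega>)))) (REL G p s t) \<epsilon> \<delta>"
proof -
  interpret prob_space M by fact
  let ?A = "weight_A G p s t" and ?W = "weight_Omega G p s t"
  define \<mu> where "\<mu> = ?A / ?W"
  have W: "?W > 0" using pos weight_A_le_weight_Omega by simp
  have e: "exp 1 - 2 \<ge> (1 / 2 :: real)" by (rule exp_one_minus_two_ge)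
  have ln_pos: "ln (2 / \<delta>) > 0" using \<delta> by simp
  \<comment> \<open>The required sample size is positive, so division by \<open>N\<close> is
    genuine.\<close>
  have "0 < 4 * (exp 1 - 2) * ln (2 / \<delta>) * (?W / (\<epsilon>\<^sup>2 * ?A))"
    using e ln_pos W pos \<epsilon> by simp
  with N have N0: "real N > 0" by linarith
  have rv: "random_variable (count_space UNIV) (X i)" if "i \<in> {1..N}" for i
    using indep that by (auto simp: indep_vars_def)
  have indep_f: "indep_vars (\<lambda>_. borel) (\<lambda>i \<omega>. f (X i \<omega>)) {1..N}"
    by (rule indep_vars_compose2[OF indep]) simp
  have mean: "expectation (\<lambda>\<omega>. f (X i \<omega>)) = \<mu>" if i: "i \<in> {1..N}" for i
  proof -
    have "expectation (\<lambda>\<omega>. f (X i \<omega>)) = integral\<^sup>L (distr M (count_space UNIV) (X i)) f"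
      by (rule integral_distr[symmetric, OF rv[OF i]]) simp
    then show ?thesis using distr i expectation_sample_pmf[of f] fibre by (simp add: \<mu>_def)
  qed
  \<comment> \<open>The sample size hypothesis, solved for the Chernoff exponent; each tail is then
    at most \<open>\<delta> / 2\<close>.\<close>
  have "ln (2 / \<delta>) \<le> real N * \<mu> * \<epsilon>\<^sup>2 / (4 * (exp 1 - 2))"
    using N e W pos \<epsilon> by (simp add: \<mu>_def field_simps)
  then have "exp (- (real N * \<mu> * \<epsilon>\<^sup>2 / (4 * (exp 1 - 2)))) \<le> exp (- ln (2 / \<delta>))" by simp
  also have "\<dots> = \<delta> / 2" using \<delta> by (simp add: exp_minus)
  finally have "1 - \<delta> \<le> 1 - 2 * exp (- (real N * \<mu> * \<epsilon>\<^sup>2 / (4 * (exp 1 - 2))))" by simp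
  also have "\<dots> \<le> prob {\<omega> \<in> space M. (1 - \<epsilon>) * (real N * \<mu>) \<le> (\<Sum>i=1..N. f (X i \<omega>))
      \<and> (\<Sum>i=1..N. f (X i \<omega>)) \<le> (1 + \<epsilon>) * (real N * \<mu>)}"
    using chernoff_relative_error[OF _ indep_f f mean, of \<epsilon>] W pos \<epsilon> by (simp add: \<mu>_def)
  \<comment> \<open>Scaling by \<open>?W / real N\<close> preserves relative error and turns the
    mean \<open>real N * \<mu>\<close> into \<open>?A\<close>.\<close>
  also have "{\<omega> \<in> space M. (1 - \<epsilon>) * (real N * \<mu>) \<le> (\<Sum>i=1..N. f (X i \<omega>))
      \<and> (\<Sum>i=1..N. f (X i \<omega>)) \<le> (1 + \<epsilon>) * (real N * \<mu>)}
    = {\<omega> \<in> space M. (1 - \<epsilon>) * ?A \<le> ?W * (1 / real N * (\<Sum>i=1..N. f (X i \<omega>)))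
      \<and> ?W * (1 / real N * (\<Sum>i=1..N. f (X i \<omega>))) \<le> (1 + \<epsilon>) * ?A}"
    using N0 W by (simp add: \<mu>_def field_simps)
  finally have "1 - \<delta> \<le> prob {\<omega> \<in> space M.
      (1 - \<epsilon>) * ?A \<le> ?W * (1 / real N * (\<Sum>i=1..N. f (X i \<omega>)))
      \<and> ?W * (1 / real N * (\<Sum>i=1..N. f (X i \<omega>))) \<le> (1 + \<epsilon>) * ?A}" .
  moreover have "(\<lambda>\<omega>. f (X i \<omega>)) \<in> borel_measurable M" if "i \<in> {1..N}" for i
    using indep_f that by (auto simp: indep_vars_def)
  ultimately show ?thesis
    by (simp add: eps_delta_approximation_def REL_eq_weight_A)
qed

end

end

section \<open>The two estimators\<close>

theorem theorem3:
  fixes G :: "('v, 'e) pre_digraph"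
    and p :: "'e \<Rightarrow> real"
    and s t :: 'v
    and c :: "'e set \<Rightarrow> 'e set"
    and M :: "'m measure"
    and X :: "nat \<Rightarrow> 'm \<Rightarrow> 'e set \<times> 'e set"
    and N :: nat
    and \<epsilon> \<delta> :: real
  assumes "fin_digraph G" and "acyclic_digraph G"
    and "s \<in> verts G" and "t \<in> verts G"
    and "\<forall>e\<in>arcs G. 0 \<le> p e \<and> p e \<le> 1"
    and "weight_A G p s t > 0"
    and "\<forall>a\<in>good_states G s t. c a \<in> st_paths_in G s t a"
    and "prob_space M"
    and "prob_space.indep_vars M (\<lambda>_. count_space UNIV) X {1..N}"
    and "\<forall>i\<in>{1..N}. distr M (count_space UNIV) (X i) = measure_pmf (sample_pmf G p s t)"
    and "0 < \<epsilon>" and "\<epsilon> < 1" and "0 < \<delta>" and "\<delta> < 1"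
    and "real N \<ge> 4 * (exp 1 - 2) * ln (2 / \<delta>) * (weight_Omega G p s t / (\<epsilon>\<^sup>2 * weight_A G p s t))"
  shows "eps_delta_approximation M
           (\<lambda>\<omega>. weight_Omega G p s t * xi c N (\<lambda>i. X i \<omega>)) (REL G p s t) \<epsilon> \<delta>
       \<and> eps_delta_approximation M
           (\<lambda>\<omega>. weight_Omega G p s t * psi G s t N (\<lambda>i. X i \<omega>)) (REL G p s t) \<epsilon> \<delta>"
proof -
  have fin: "finite (arcs G)" using assms(1) by (rule fin_digraph.finite_arcs)
  note approx = eps_delta_approximation_sample_mean[OF fin assms(5,6,8-15)]
  note finP = finite_st_paths_in[OF fin assms(5), of s t]
  have xi: "xi c N x = 1 / real N * (\<Sum>i=1..N. of_bool (fst (x i) = c (snd (x i))))" for x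
    by (simp add: xi_def Int_def)
  \<comment> \<open>Exactly one path of the fibre equals \<open>c a\<close>, since
    \<open>c a\<close> is itself a path in \<open>a\<close>.\<close>
  have "(\<Sum>\<gamma>\<in>st_paths_in G s t a. of_bool (\<gamma> = c a)) = (1::real)" if "a \<in> good_states G s t" for a
    using that assms(7) finP by (simp add: of_bool_def)
  moreover have "(\<Sum>\<gamma>\<in>st_paths_in G s t a. 1 / real (card (st_paths_in G s t a))) = 1"
    if "a \<in> good_states G s t" for a
    using that finP by (auto simp: good_states_def)
  \<comment> \<open>The case \<open>n = 0\<close>, where the quotient is 0, covers states without a
    path: the range condition on \<open>f\<close> is imposed on all pairs.\<close>
  moreover have "1 / real n \<le> 1" for n
    by (cases n) auto
  ultimately show ?thesis
    unfolding xi psi_def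
    by (intro conjI approx[of "\<lambda>x. of_bool (fst x = c (snd x))"]
        approx[of "\<lambda>x. 1 / real (card (st_paths_in G s t (snd x)))"]) auto
qed

end
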